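(* Let $k\ge 0$ be an integer. Assigning $p_\alpha$ to $\alpha\in \mathrm{Rec}_k$ and $\alpha_p$ to $p\in \mathcal{T}^{\vee}_k\setminus D_k$ establishes a bijection $$\mathrm{Rec}_k\;\cong\;\mathcal{T}^{\vee}_k\setminus D_k .$$
   Context: The ground field is $\mathbb{C}$; points of varieties are $\mathbb{C}$-points. A series $\alpha=(\alpha_{\ell,g})_{\ell,g\ge0}$ of complex numbers is identified with the linear functional $\alpha:\mathbb{C}[T_1,T_2]\to\mathbb{C}$, $\alpha(T_1^\ell T_2^g)=\alpha_{\ell,g}$. It is recognizable if $\ker(\alpha)$ contains an ideal of finite codimension; then $I_\alpha=\{z:\alpha(zf)=0\ \forall f\in\mathbb{C}[T_1,T_2]\}$ is the largest ideal contained in $\ker(\alpha)$, and it has finite codimension. $\mathrm{Rec}_k$ is the set of recognizable series $\alpha$ with $\operatorname{codim} I_\alpha=k$ ($\mathrm{Rec}_0$ consists of the zero series). $H^k=\mathrm{Hilb}^k(\mathbb{C}^2)$ is the Hilbert scheme of $k$ points in $\mathbb{C}^2$, i.e. of codimension $k$ ideals of $\mathbb{C}[T_1,T_2]$. $\mathcal{T}_k\to H^k$ is the tautological bundle, with fiber $A_I=\mathbb{C}[T_1,T_2]/I$ over the ideal $I$, and $\pi:\mathcal{T}_k^\vee\to H^k$ is the dual bundle, so a point $p\in\mathcal{T}_k^\vee$ is an ideal $I_{\pi(p)}$ of codimension $k$ together with a linear functional on $A_{\pi(p)}=\mathbb{C}[T_1,T_2]/I_{\pi(p)}$. This functional, and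 its lift to a functional on $\mathbb{C}[T_1,T_2]$ (which is recognizable), are both denoted $\alpha_p$. Let $I_p=I_{\alpha_p}\supset I_{\pi(p)}$, and $D_k=\{p\in\mathcal{T}_k^\vee : I_{\pi(p)}\neq I_p\}$. For $\alpha\in\mathrm{Rec}_k$, $p_\alpha\in\mathcal{T}_k^\vee$ is the point in the fiber over the ideal $I_\alpha$ given by the functional induced by $\alpha$ on $\mathbb{C}[T_1,T_2]/I_\alpha$. *)

theory Defs
  imports
    "HOL-Library.Poly_Mapping"
    "HOL-Library.Product_Plus"
    "HOL-Library.FuncSet"
    "HOL-Algebra.QuotRing"
    "Jordan_Normal_Form.VS_Connect"
begin

text \<open>The ring \<open>\<complex>[T\<^sub>1, T\<^sub>2]\<close>: the key \<open>(l, g)\<close> is the exponent vector of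
  \<open>T\<^sub>1\<^sup>l T\<^sub>2\<^sup>g\<close>, and the type class multiplication is the convolution product.\<close>

type_synonym poly2 = "(nat \<times> nat) \<Rightarrow>\<^sub>0 complex"

type_synonym series = "nat \<Rightarrow> nat \<Rightarrow> complex"

definition T1 :: poly2 where "T1 = Poly_Mapping.single (1, 0) 1"

definition T2 :: poly2 where "T2 = Poly_Mapping.single (0, 1) 1"

definition const2 :: "complex \<Rightarrow> poly2" where "const2 c = Poly_Mapping.single (0, 0) c"

abbreviation poly2_ring :: "poly2 ring" where "poly2_ring \<equiv> class_ring"

abbreviation complex_field :: "complex ring" where "complex_field \<equiv> class_ring"

definition complex_space :: "(complex, complex) module" where
  "complex_space = \<lparr>carrier = UNIV, mult = (*), one = 1, zero = 0, add = (+), smult = (*)\<rparr>"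

definition functional :: "series \<Rightarrow> poly2 \<Rightarrow> complex" where
  "functional \<alpha> f =
     (\<Sum>(l, g)\<in>Poly_Mapping.keys f. Poly_Mapping.lookup f (l, g) * \<alpha> l g)"

lemma T1_T2_power: "T1 ^ l * T2 ^ g = Poly_Mapping.single (l, g) 1"
proof -
  have "T1 ^ l = Poly_Mapping.single (l, 0) 1"
    by (induction l) (simp_all add: T1_def Poly_Mapping.mult_single zero_prod_def flip: single_one)
  moreover have "T2 ^ g = Poly_Mapping.single (0, g) 1"
    by (induction g) (simp_all add: T2_def Poly_Mapping.mult_single zero_prod_def flip: single_one)
  ultimately show ?thesis
    by (simp add: Poly_Mapping.mult_single)
qed

lemma functional_monomial: "functional \<alpha> (T1 ^ l * T2 ^ g) = \<alpha> l g"
  by (simp add: T1_T2_power functional_def)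

text \<open>The quotient \<open>A\<^sub>I = \<complex>[T\<^sub>1, T\<^sub>2]/I\<close> as a complex vector space. A scalar acts by
  multiplication with the class of the corresponding constant polynomial.\<close>

definition quot_space :: "poly2 set \<Rightarrow> (complex, poly2 set) module" where
  "quot_space I = (let Q = poly2_ring Quot I in
     \<lparr>carrier = carrier Q, mult = mult Q, one = one Q, zero = zero Q, add = add Q,
      smult = (\<lambda>c A. (I +>\<^bsub>poly2_ring\<^esub> const2 c) \<otimes>\<^bsub>Q\<^esub> A)\<rparr>)"

definition finite_codim :: "poly2 set \<Rightarrow> bool" where
  "finite_codim I \<longleftrightarrow> vectorspace.fin_dim complex_field (quot_space I)"

text \<open>Only meaningful if \<^term>\<open>finite_codim I\<close> holds.\<close>

definition codim :: "poly2 set \<Rightarrow> nat" where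
  "codim I = vectorspace.dim complex_field (quot_space I)"

definition recognizable :: "series \<Rightarrow> bool" where
  "recognizable \<alpha> \<longleftrightarrow>
     (\<exists>I. ideal I poly2_ring \<and> finite_codim I \<and> I \<subseteq> {f. functional \<alpha> f = 0})"

definition series_ideal :: "series \<Rightarrow> poly2 set" where
  "series_ideal \<alpha> = {z. \<forall>f. functional \<alpha> (z * f) = 0}"

definition Rec :: "nat \<Rightarrow> series set" where
  "Rec k = {\<alpha>. recognizable \<alpha> \<and> codim (series_ideal \<alpha>) = k}"

text \<open>The \<open>\<complex>\<close>-points of \<open>Hilb\<^sup>k(\<complex>\<^sup>2)\<close>.\<close>

definition Hilb :: "nat \<Rightarrow> poly2 set set" where
  "Hilb k = {I. ideal I poly2_ring \<and> finite_codim I \<and> codim I = k}"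

text \<open>Linear functionals on \<open>A\<^sub>I\<close>. Functions are total, so the value outside
  of \<open>A\<^sub>I\<close> is fixed by \<^const>\<open>extensional\<close>.\<close>

definition dual_fiber :: "poly2 set \<Rightarrow> (poly2 set \<Rightarrow> complex) set" where
  "dual_fiber I = LinearCombinations.module_hom complex_field (quot_space I) complex_space
     \<inter> extensional (carrier (quot_space I))"

text \<open>The \<open>\<complex>\<close>-points of the total space of the dual of the tautological bundle; the bundle
  projection is \<^const>\<open>fst\<close>.\<close>

definition taut_dual :: "nat \<Rightarrow> (poly2 set \<times> (poly2 set \<Rightarrow> complex)) set" where
  "taut_dual k = (SIGMA I:Hilb k. dual_fiber I)"

definition lift_functional :: "poly2 set \<times> (poly2 set \<Rightarrow> complex) \<Rightarrow> poly2 \<Rightarrow> complex" where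
  "lift_functional p f = snd p (fst p +>\<^bsub>poly2_ring\<^esub> f)"

text \<open>The series \<open>\<alpha>\<^sub>p\<close>, that is, the series identified with \<^term>\<open>lift_functional p\<close>.\<close>

definition series_of_point :: "poly2 set \<times> (poly2 set \<Rightarrow> complex) \<Rightarrow> series" where
  "series_of_point p = (\<lambda>l g. lift_functional p (T1 ^ l * T2 ^ g))"

definition D :: "nat \<Rightarrow> (poly2 set \<times> (poly2 set \<Rightarrow> complex)) set" where
  "D k = {p \<in> taut_dual k. fst p \<noteq> series_ideal (series_of_point p)}"

text \<open>The point \<open>p\<^sub>\<alpha>\<close>. The functional of \<open>\<alpha>\<close> is constant on each coset of \<open>I\<^sub>\<alpha>\<close>; the
  induced functional sends a coset to this common value.\<close>

definition point_of_series :: "series \<Rightarrow> poly2 set \<times> (poly2 set \<Rightarrow> complex)" where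
  "point_of_series \<alpha> =
     (series_ideal \<alpha>,
      \<lambda>A\<in>carrier (quot_space (series_ideal \<alpha>)). the_elem (functional \<alpha> ` A))"

end

theory Submission
  imports Defs
begin

text \<open>A series \<open>\<alpha>\<close> and a point \<open>p\<close> of the dual tautological bundle are two encodings of a linear
  functional on the polynomial ring: \<open>\<alpha>\<close> lists its values on the monomials, and \<open>p\<close> factors it
  through a quotient by an ideal. Passing to \<open>\<alpha>\<close> and back to the quotient by \<open>I\<^sub>\<alpha>\<close> never changes the
  functional; the only information in \<open>p\<close> beyond the functional is the ideal itself. Outside of
  \<open>D\<^sub>k\<close> that ideal is \<open>I\<^sub>\<alpha>\<close>, so it is determined by the functional, and the two assignments
  are mutually inverse.

  Two facts carry the argument. First, a functional which is additive and commutes with constants is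
  determined by its values on monomials (\<open>functional_of_monomial_values\<close>), so that \<open>\<alpha>\<^sub>p\<close>, which is
  read off from monomials only, is the whole lift of \<open>p\<close> (\<open>functional_series_of_point\<close>). Second,
  \<open>I\<^sub>\<alpha>\<close> must be a point of the Hilbert scheme. Recognizability only provides some ideal of finite
  codimension in the kernel of \<open>\<alpha>\<close>; it lies in \<open>I\<^sub>\<alpha>\<close> because \<open>I\<^sub>\<alpha>\<close> is the largest ideal in the
  kernel, and a larger ideal has a smaller quotient (\<open>finite_codim_mono\<close>).\<close>

section \<open>Linear functionals on polynomials\<close>

lemma poly2_sum_monomials:
  "(f :: poly2) = (\<Sum>m\<in>Poly_Mapping.keys f. Poly_Mapping.single m (Poly_Mapping.lookup f m))"
  by (rule poly_mapping_eqI)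
    (simp add: lookup_sum lookup_single when_def sum.delta' in_keys_iff)

text \<open>Sums over the support are awkward to compare for different polynomials. Zero coefficients
  contribute nothing, so any finite set containing the support may serve as index set.\<close>

lemma functional_eq_sum:
  assumes "finite S" "Poly_Mapping.keys f \<subseteq> S"
  shows "functional \<alpha> f = (\<Sum>m\<in>S. Poly_Mapping.lookup f m * \<alpha> (fst m) (snd m))"
  unfolding functional_def case_prod_beta prod.collapse
  using assms by (intro sum.mono_neutral_left) (auto simp: in_keys_iff)

lemma functional_add: "functional \<alpha> (f + g) = functional \<alpha> f + functional \<alpha> g"
proof -
  let ?S = "Poly_Mapping.keys f \<union> Poly_Mapping.keys g"
  have "finite ?S" "Poly_Mapping.keys (f + g) \<subseteq> ?S"
    by (auto dest: subsetD[OF Poly_Mapping.keys_add])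
  then show ?thesis
    by (simp add: functional_eq_sum[of ?S] lookup_add algebra_simps sum.distrib)
qed

lemma functional_zero: "functional \<alpha> 0 = 0"
  by (simp add: functional_def)

lemma functional_uminus: "functional \<alpha> (- f) = - functional \<alpha> f"
  using functional_add[of \<alpha> f "- f"] by (simp add: functional_zero add_eq_0_iff)

lemma functional_diff: "functional \<alpha> (f - g) = functional \<alpha> f - functional \<alpha> g"
  using functional_add[of \<alpha> f "- g"] by (simp add: functional_uminus)

lemma lookup_const2_mult: "Poly_Mapping.lookup (const2 c * f) m = c * Poly_Mapping.lookup f m"
proof -
  have "const2 c * f = Poly_Mapping.map ((*) c) f" 
    unfolding const2_def by (simp add: mult_map_scale_conv_mult zero_prod_def[symmetric])
  then show ?thesis by (simp add: map.rep_eq when_def)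
qed

lemma functional_const2_mult: "functional \<alpha> (const2 c * f) = c * functional \<alpha> f"
proof -
  have "Poly_Mapping.keys (const2 c * f) \<subseteq> Poly_Mapping.keys f"
    by (auto simp: in_keys_iff lookup_const2_mult)
  then show ?thesis
    by (simp add: functional_eq_sum[of "Poly_Mapping.keys f"] lookup_const2_mult sum_distrib_left
        mult.assoc)
qed

text \<open>The monomials span the polynomial ring over the constants.\<close>

lemma functional_of_monomial_values:
  assumes add: "\<And>f g. L (f + g) = L f + L g"
    and smult: "\<And>c f. L (const2 c * f) = c * L f"
  shows "functional (\<lambda>l g. L (T1 ^ l * T2 ^ g)) f = L f"
proof -
  have zero: "L 0 = 0"
    using add[of 0 0] by simp
  have sum: "L (\<Sum>m\<in>S. h m) = (\<Sum>m\<in>S. L (h m))" for S and h :: "nat \<times> nat \<Rightarrow> poly2"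
    by (induction S rule: infinite_finite_induct) (simp_all add: zero add)
  have mon: "Poly_Mapping.single m c = const2 c * (T1 ^ fst m * T2 ^ snd m)" for m c
    using plus_prod_def[of "(0::nat, 0::nat)" m]
    by (simp add: T1_T2_power const2_def Poly_Mapping.mult_single)
  have "L f = (\<Sum>m\<in>Poly_Mapping.keys f. L (Poly_Mapping.single m (Poly_Mapping.lookup f m)))"
    by (subst poly2_sum_monomials[of f]) (rule sum)
  also have "\<dots> = functional (\<lambda>l g. L (T1 ^ l * T2 ^ g)) f"
    by (simp only: mon smult) (simp add: functional_def case_prod_beta)
  finally show ?thesis ..
qed

section \<open>The quotient by an ideal as a vector space\<close>

abbreviation coset :: "poly2 set \<Rightarrow> poly2 \<Rightarrow> poly2 set" where
  "coset I f \<equiv> I +>\<^bsub>poly2_ring\<^esub> f"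

lemma coset_eq_iff:
  assumes "ideal I poly2_ring"
  shows "coset I f = coset I g \<longleftrightarrow> f - g \<in> I"
  using ring.quotient_eq_iff_same_a_r_cos[OF class_ring.ring_axioms assms, of f g]
  by (simp add: class_ring_simps)

lemma mem_coset_iff: "g \<in> coset I f \<longleftrightarrow> g - f \<in> I"
proof
  show "g - f \<in> I" if "g \<in> coset I f"
    using that by (auto simp: a_r_coset_def')
  show "g \<in> coset I f" if "g - f \<in> I"
    using that by (auto simp: a_r_coset_def' intro!: bexI[of _ "g - f"])
qed

lemma coset_zero: "coset I 0 = I"
  by (auto simp: mem_coset_iff)

lemma carrier_quot_space: "carrier (quot_space I) = range (coset I)"
  by (auto simp: quot_space_def Let_def FactRing_def A_RCOSETS_def')

lemma zero_quot_space: "\<zero>\<^bsub>quot_space I\<^esub> = coset I 0"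
  by (simp add: quot_space_def Let_def FactRing_def coset_zero)

lemma add_quot_space:
  assumes "ideal I poly2_ring"
  shows "coset I f \<oplus>\<^bsub>quot_space I\<^esub> coset I g = coset I (f + g)"
  using ideal.a_rcos_sum[OF assms, of f g] by (simp add: quot_space_def Let_def FactRing_def)

lemma smult_quot_space:
  assumes "ideal I poly2_ring"
  shows "c \<odot>\<^bsub>quot_space I\<^esub> coset I f = coset I (const2 c * f)"
  using ideal.rcoset_mult_add[OF assms, of "const2 c" f]
  by (simp add: quot_space_def Let_def FactRing_def)

lemma const2_add: "const2 (c + d) = const2 c + const2 d"
  by (simp add: const2_def single_add)

lemma const2_mult: "const2 (c * d) = const2 c * const2 d"
  by (simp add: const2_def Poly_Mapping.mult_single)

lemma const2_one: "const2 1 = 1"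
  by (simp add: const2_def flip: zero_prod_def)

lemma vectorspace_quot_space:
  assumes "ideal I poly2_ring"
  shows "vectorspace complex_field (quot_space I)"
proof -
  let ?V = "quot_space I"
  note ops = zero_quot_space add_quot_space[OF assms] smult_quot_space[OF assms]
  have coset_ex: "\<exists>f. v = coset I f" if "v \<in> carrier ?V" for v
    using that by (auto simp: carrier_quot_space)
  have coset_in: "coset I f \<in> carrier ?V" for f
    by (simp add: carrier_quot_space)
  have "abelian_group ?V"
  proof (rule abelian_groupI)
    fix u v w assume "u \<in> carrier ?V" "v \<in> carrier ?V" "w \<in> carrier ?V"
    then obtain f g h where "u = coset I f" "v = coset I g" "w = coset I h"
      using coset_ex by metis
    then show "u \<oplus>\<^bsub>?V\<^esub> v \<oplus>\<^bsub>?V\<^esub> w = u \<oplus>\<^bsub>?V\<^esub> (v \<oplus>\<^bsub>?V\<^esub> w)"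
      by (simp only: ops add.assoc)
  next
    fix u v assume "u \<in> carrier ?V" "v \<in> carrier ?V"
    then obtain f g where uv: "u = coset I f" "v = coset I g"
      using coset_ex by metis
    show "u \<oplus>\<^bsub>?V\<^esub> v \<in> carrier ?V"
      by (simp only: uv ops coset_in)
    show "u \<oplus>\<^bsub>?V\<^esub> v = v \<oplus>\<^bsub>?V\<^esub> u"
      by (simp only: uv ops add.commute)
  next
    fix u assume "u \<in> carrier ?V"
    then obtain f where u: "u = coset I f"
      using coset_ex by metis
    show "\<zero>\<^bsub>?V\<^esub> \<oplus>\<^bsub>?V\<^esub> u = u"
      by (simp only: u ops add_0_left)
    have "coset I (- f) \<oplus>\<^bsub>?V\<^esub> u = \<zero>\<^bsub>?V\<^esub>"
      by (simp only: u ops left_minus)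
    then show "\<exists>v\<in>carrier ?V. v \<oplus>\<^bsub>?V\<^esub> u = \<zero>\<^bsub>?V\<^esub>"
      using coset_in by blast
  qed (simp only: ops coset_in)
  then have "module complex_field ?V"
  proof (rule moduleI[OF class_cring.cring_axioms])
    fix c d u v assume "u \<in> carrier ?V" "v \<in> carrier ?V"
    then obtain f g where uv: "u = coset I f" "v = coset I g"
      using coset_ex by metis
    show "c \<odot>\<^bsub>?V\<^esub> (u \<oplus>\<^bsub>?V\<^esub> v) = c \<odot>\<^bsub>?V\<^esub> u \<oplus>\<^bsub>?V\<^esub> c \<odot>\<^bsub>?V\<^esub> v"
      by (simp only: uv ops distrib_left)
  next
    fix c d u assume "u \<in> carrier ?V"
    then obtain f where u: "u = coset I f"
      using coset_ex by metis
    show "c \<odot>\<^bsub>?V\<^esub> u \<in> carrier ?V"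
      by (simp only: u ops coset_in)
    show "(c \<oplus>\<^bsub>complex_field\<^esub> d) \<odot>\<^bsub>?V\<^esub> u = c \<odot>\<^bsub>?V\<^esub> u \<oplus>\<^bsub>?V\<^esub> d \<odot>\<^bsub>?V\<^esub> u"
      by (simp only: u ops class_ring_simps const2_add distrib_right)
    show "(c \<otimes>\<^bsub>complex_field\<^esub> d) \<odot>\<^bsub>?V\<^esub> u = c \<odot>\<^bsub>?V\<^esub> (d \<odot>\<^bsub>?V\<^esub> u)"
      by (simp only: u ops class_ring_simps const2_mult mult.assoc)
    show "\<one>\<^bsub>complex_field\<^esub> \<odot>\<^bsub>?V\<^esub> u = u"
      by (simp only: u ops class_ring_simps const2_one mult_1_left)
  qed
  then show ?thesis
    using class_field.field_axioms by (simp add: vectorspace_def)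
qed

text \<open>The inclusion of \<open>I\<close> in \<open>J\<close> induces a linear surjection of the quotients, and the image of a
  finite-dimensional space is finite-dimensional.\<close>

lemma finite_codim_mono:
  assumes I: "ideal I poly2_ring" and J: "ideal J poly2_ring"
    and sub: "I \<subseteq> J" and I_fin: "finite_codim I"
  shows "finite_codim J"
proof -
  \<comment> \<open>For a coset \<open>A\<close> of \<open>I\<close> all members of the union are the same coset of \<open>J\<close>.\<close>
  define T where "T A = (\<Union>f\<in>A. coset J f)" for A
  have T: "T (coset I f) = coset J f" for f
  proof -
    have "f \<in> coset I f"
      using additive_subgroup.zero_closed[OF ideal.axioms(1)[OF I]] by (simp add: mem_coset_iff)
    moreover have "coset J g = coset J f" if "g \<in> coset I f" for g
      using that sub by (auto simp: mem_coset_iff coset_eq_iff[OF J])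
    ultimately show ?thesis
      unfolding T_def by blast
  qed
  have "T \<in> LinearCombinations.module_hom complex_field (quot_space I) (quot_space J)"
    by (auto simp: LinearCombinations.module_hom_def carrier_quot_space T add_quot_space[OF I] add_quot_space[OF J]
        smult_quot_space[OF I] smult_quot_space[OF J])
  then interpret linear_map complex_field "quot_space I" "quot_space J" T
    using vectorspace_quot_space[OF I] vectorspace_quot_space[OF J]
    by (simp add: linear_map_def mod_hom_def mod_hom_axioms_def vectorspace_def)
  have "T ` carrier (quot_space I) = carrier (quot_space J)"
    by (auto simp: carrier_quot_space T image_image)
  then show ?thesis
    using rank_nullity_main(2)[OF I_fin[unfolded finite_codim_def]]
    unfolding finite_codim_def by simp
qed

section \<open>The ideal of a series and points of the dual tautological bundle\<close>

lemma ideal_series_ideal: "ideal (series_ideal \<alpha>) poly2_ring"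
proof (rule idealI)
  show "ring poly2_ring"
    by (rule class_ring.ring_axioms)
  show "subgroup (series_ideal \<alpha>) (add_monoid poly2_ring)"
  proof (rule group.subgroupI)
    show "group (add_monoid poly2_ring)"
      by (rule abelian_group.a_group[OF ring.is_abelian_group[OF class_ring.ring_axioms]])
    show "inv\<^bsub>add_monoid poly2_ring\<^esub> a \<in> series_ideal \<alpha>" if "a \<in> series_ideal \<alpha>" for a
    proof -
      have "inv\<^bsub>add_monoid poly2_ring\<^esub> a = - a"
        unfolding a_inv_def[symmetric] by (simp only: class_ring_simps)
      then show ?thesis
        using that by (simp add: series_ideal_def functional_uminus)
    qed
    show "series_ideal \<alpha> \<noteq> {}"
      by (auto simp: series_ideal_def functional_zero intro: exI[of _ 0])
  qed (auto simp: series_ideal_def functional_add distrib_right)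
  show "x \<otimes>\<^bsub>poly2_ring\<^esub> a \<in> series_ideal \<alpha>" "a \<otimes>\<^bsub>poly2_ring\<^esub> x \<in> series_ideal \<alpha>"
    if "a \<in> series_ideal \<alpha>" for a x
    using that by (simp_all add: series_ideal_def mult.assoc mult.left_commute[of x a])
qed

text \<open>The next two lemmas say that \<open>I\<^sub>\<alpha>\<close> is the largest ideal in the kernel: the multiplier 1 shows
  that \<open>\<alpha>\<close> vanishes on \<open>I\<^sub>\<alpha>\<close>, and an ideal in the kernel absorbs every multiplier.\<close>

lemma series_ideal_subset_ker: "series_ideal \<alpha> \<subseteq> {f. functional \<alpha> f = 0}"
  unfolding series_ideal_def by (auto dest: spec[of _ 1])

lemma ideal_subset_series_ideal:
  assumes "ideal I poly2_ring" "I \<subseteq> {f. functional \<alpha> f = 0}"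
  shows "I \<subseteq> series_ideal \<alpha>"
  using ideal.I_r_closed[OF assms(1)] assms(2) by (auto simp: series_ideal_def)

lemma finite_codim_series_ideal: "recognizable \<alpha> \<Longrightarrow> finite_codim (series_ideal \<alpha>)"
  unfolding recognizable_def
  using finite_codim_mono ideal_series_ideal ideal_subset_series_ideal by blast

lemma the_elem_functional_coset:
  assumes I: "ideal I poly2_ring" and ker: "I \<subseteq> {f. functional \<alpha> f = 0}"
  shows "the_elem (functional \<alpha> ` coset I f) = functional \<alpha> f"
proof -
  have "f \<in> coset I f"
    using additive_subgroup.zero_closed[OF ideal.axioms(1)[OF I]] by (simp add: mem_coset_iff)
  moreover have "functional \<alpha> g = functional \<alpha> f" if "g \<in> coset I f" for g
    using that ker functional_diff[of \<alpha> g f] by (auto simp: mem_coset_iff)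
  ultimately have "functional \<alpha> ` coset I f = {functional \<alpha> f}"
    by blast
  then show ?thesis
    by simp
qed

text \<open>Because \<open>I\<^sub>\<alpha>\<close> lies in the kernel, the functional is constant on its cosets, so nothing is lost
  by passing to the quotient.\<close>

lemma lift_functional_point_of_series: "lift_functional (point_of_series \<alpha>) f = functional \<alpha> f"
  by (simp add: lift_functional_def point_of_series_def carrier_quot_space
      the_elem_functional_coset[OF ideal_series_ideal series_ideal_subset_ker])

lemma series_of_point_of_series: "series_of_point (point_of_series \<alpha>) = \<alpha>"
  by (simp add: series_of_point_def lift_functional_point_of_series functional_monomial)

text \<open>This identifies the series \<open>\<alpha>\<^sub>p\<close>, defined by monomials, with the lift of \<open>p\<close>; from here on
  kernels and ideals of \<open>\<alpha>\<^sub>p\<close> can be computed from the lift.\<close>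

lemma functional_series_of_point:
  assumes "p \<in> taut_dual k"
  shows "functional (series_of_point p) f = lift_functional p f"
proof -
  obtain I \<phi> where p: "p = (I, \<phi>)" and I: "ideal I poly2_ring"
    and \<phi>: "\<phi> \<in> LinearCombinations.module_hom complex_field (quot_space I) complex_space"
    using assms by (auto simp: taut_dual_def Hilb_def dual_fiber_def)
  have "lift_functional p (f + g) = lift_functional p f + lift_functional p g" for f g
    using LinearCombinations.module_hom_add[OF \<phi>, of "coset I f" "coset I g"]
    by (simp add: p lift_functional_def carrier_quot_space add_quot_space[OF I] complex_space_def)
  moreover have "lift_functional p (const2 c * f) = c * lift_functional p f" for c f
    using LinearCombinations.module_hom_smult[OF \<phi>, of c "coset I f"]
    by (simp add: p lift_functional_def carrier_quot_space smult_quot_space[OF I] complex_space_def)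
  ultimately show ?thesis
    unfolding series_of_point_def by (rule functional_of_monomial_values)
qed

lemma fst_subset_ker_series_of_point:
  assumes "p \<in> taut_dual k"
  shows "fst p \<subseteq> {f. functional (series_of_point p) f = 0}"
proof
  fix f assume f: "f \<in> fst p"
  have I: "ideal (fst p) poly2_ring"
    using assms by (auto simp: taut_dual_def Hilb_def)
  have "coset (fst p) f = coset (fst p) 0"
    using f by (simp add: coset_eq_iff[OF I])
  then have "lift_functional p f = lift_functional p 0"
    by (simp add: lift_functional_def)
  also have "\<dots> = 0"
    using functional_series_of_point[OF assms, of 0] by (simp add: functional_zero)
  finally show "f \<in> {f. functional (series_of_point p) f = 0}"
    by (simp add: functional_series_of_point[OF assms])
qed

text \<open>With equal ideals, both points are functionals on the same quotient with the same lift, and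
  the projection to the quotient is surjective.\<close>

lemma point_of_series_of_point:
  assumes p: "p \<in> taut_dual k" and eq: "fst p = series_ideal (series_of_point p)"
  shows "point_of_series (series_of_point p) = p"
proof (rule prod_eqI)
  let ?\<alpha> = "series_of_point p"
  show "fst (point_of_series ?\<alpha>) = fst p"
    by (simp add: point_of_series_def eq)
  have ext: "snd p \<in> extensional (carrier (quot_space (fst p)))"
    using p by (auto simp: taut_dual_def dual_fiber_def)
  show "snd (point_of_series ?\<alpha>) = snd p"
  proof (rule extensionalityI[OF _ ext])
    show "snd (point_of_series ?\<alpha>) \<in> extensional (carrier (quot_space (fst p)))"
      by (simp add: point_of_series_def flip: eq)
    fix A assume "A \<in> carrier (quot_space (fst p))"
    then obtain f where A: "A = coset (fst p) f"
      by (auto simp: carrier_quot_space)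
    have "snd (point_of_series ?\<alpha>) A = lift_functional (point_of_series ?\<alpha>) f"
      by (simp add: lift_functional_def point_of_series_def A flip: eq)
    also have "\<dots> = lift_functional p f"
      by (simp add: lift_functional_point_of_series functional_series_of_point[OF p])
    finally show "snd (point_of_series ?\<alpha>) A = snd p A"
      by (simp add: lift_functional_def A)
  qed
qed

lemma point_of_series_in_taut_dual:
  assumes "\<alpha> \<in> Rec k"
  shows "point_of_series \<alpha> \<in> taut_dual k"
proof -
  let ?I = "series_ideal \<alpha>" and ?\<phi> = "snd (point_of_series \<alpha>)"
  have \<phi>: "?\<phi> (coset ?I f) = functional \<alpha> f" for f
    using lift_functional_point_of_series[of \<alpha> f]
    by (simp add: lift_functional_def point_of_series_def)
  have "?I \<in> Hilb k"
    using assms by (simp add: Hilb_def Rec_def ideal_series_ideal finite_codim_series_ideal)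
  moreover have "?\<phi> \<in> LinearCombinations.module_hom complex_field (quot_space ?I) complex_space"
    by (auto simp: LinearCombinations.module_hom_def carrier_quot_space complex_space_def \<phi> functional_add
        functional_const2_mult add_quot_space[OF ideal_series_ideal]
        smult_quot_space[OF ideal_series_ideal])
  moreover have "?\<phi> \<in> extensional (carrier (quot_space ?I))"
    by (simp add: point_of_series_def)
  ultimately show ?thesis
    by (simp add: taut_dual_def dual_fiber_def point_of_series_def)
qed

text \<open>The ideal of \<open>p\<close> itself witnesses recognizability. Equality with \<open>I\<^sub>p\<close> is needed to know the
  codimension: in general it is at most \<open>k\<close>.\<close>

lemma series_of_point_in_Rec:
  assumes p: "p \<in> taut_dual k" and eq: "fst p = series_ideal (series_of_point p)"
  shows "series_of_point p \<in> Rec k"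
proof -
  have "fst p \<in> Hilb k"
    using p by (auto simp: taut_dual_def)
  then show ?thesis
    using fst_subset_ker_series_of_point[OF p]
    by (auto simp: Rec_def Hilb_def recognizable_def simp flip: eq)
qed

theorem proposition4p1:
  fixes k :: nat
  shows "bij_betw point_of_series (Rec k) (taut_dual k - D k) \<and>
    bij_betw series_of_point (taut_dual k - D k) (Rec k) \<and>
    (\<forall>\<alpha>\<in>Rec k. series_of_point (point_of_series \<alpha>) = \<alpha>) \<and>
    (\<forall>p\<in>taut_dual k - D k. point_of_series (series_of_point p) = p)"
proof -
  have into_D: "point_of_series ` Rec k \<subseteq> taut_dual k - D k"
  proof
    fix p assume "p \<in> point_of_series ` Rec k"
    then obtain \<alpha> where \<alpha>: "\<alpha> \<in> Rec k" and p: "p = point_of_series \<alpha>"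
      by blast
    have "fst p = series_ideal (series_of_point p)"
      unfolding p series_of_point_of_series by (simp add: point_of_series_def)
    then show "p \<in> taut_dual k - D k"
      using point_of_series_in_taut_dual[OF \<alpha>] by (simp add: D_def p)
  qed
  have into_Rec: "series_of_point ` (taut_dual k - D k) \<subseteq> Rec k"
    by (auto simp: D_def intro: series_of_point_in_Rec)
  have left_inv: "\<forall>\<alpha>\<in>Rec k. series_of_point (point_of_series \<alpha>) = \<alpha>"
    by (simp add: series_of_point_of_series)
  have right_inv: "\<forall>p\<in>taut_dual k - D k. point_of_series (series_of_point p) = p"
    unfolding D_def by (auto intro: point_of_series_of_point)
  show ?thesis
    using bij_betw_byWitness[OF left_inv right_inv into_D into_Rec]
      bij_betw_byWitness[OF right_inv left_inv into_Rec into_D] left_inv right_inv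
    by (intro conjI)
qed

end
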